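(* Let $C$ be the set of elements of the free Catalan structure (equivalently, rooted plane trees, with size $|T|$ = number of edges). Let $$F=F(t,u)=\sum_{T\in C}t^{|T|}u^{\mathrm{leaves}(T)},\qquad G=G(t,p,q,u)=\sum_{T\in C}t^{|T|}p^{\mathrm{sub}(T)}q^{\mathrm{rpath}(T)}u^{\mathrm{leaves}(T)}$$ as formal power series. Then $$G(t,p,q,u)=u+\frac{tpqu\,(1-tF)}{(1-tpF)(1-tF-tq)}.$$ Equivalently, with $\Delta=(1-t+tu)^2-4tu$, $$G(t,p,q,u)=u+\frac{tpqu\,(1+t-tu+\sqrt{\Delta})}{2(1-tq-tpu)+(1-t+tu-\sqrt{\Delta})\,(tp(u+q-1)-1)}.$$
   Context: The free Catalan structure consists of the formal expressions $e$, $\lambda(t)$, and $\lambda(u)\oplus v$ with $v\neq e$, where $\oplus$ is associative with identity $e$; $|e|=0$, $|\lambda(t)|=|t|+1$, $|u\oplus v|=|u|+|v|$. It is isomorphic to rooted plane trees written as lists of children, with $e=[\,]$, $\lambda(T)=[T]$, and $\oplus$ = concatenation of child lists. Statistics (in each clause for $u\oplus v$ both $u,v\neq e$): $\mathrm{leaves}(e)=1$, $\mathrm{leaves}(\lambda(t))=\mathrm{leaves}(t)$, $\mathrm{leaves}(u\oplus v)=\mathrm{leaves}(u)+\mathrm{leaves}(v)$; $\mathrm{sub}(e)=0$, $\mathrm{sub}(\lambda(t))=1$, $\mathrm{sub}(u\oplus v)=\mathrm{sub}(u)+\mathrm{sub}(v)$; $\mathrm{rpath}(e)=0$, $\mathrm{rpath}(\lambda(t))=1+\mathrm{rpath}(t)$,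 $\mathrm{rpath}(u\oplus v)=\mathrm{rpath}(v)$. On plane trees these are the number of leaves, the number of children of the root, and the length of the rightmost path from the root. $\sqrt{\Delta}$ denotes the power series in $t$ with constant term $1$; $F$ satisfies $F(t,u)=\frac{1-t+tu-\sqrt{\Delta}}{2t}$. *)

theory Defs
  imports "HOL-Computational_Algebra.Formal_Power_Series"
begin

section \<open>The free Catalan structure, as rooted plane trees\<close>

datatype plane_tree = Node (children: "plane_tree list")

definition cat_e :: plane_tree where
  "cat_e = Node []"

definition cat_lam :: "plane_tree \<Rightarrow> plane_tree" where
  "cat_lam T = Node [T]"

definition cat_plus :: "plane_tree \<Rightarrow> plane_tree \<Rightarrow> plane_tree" (infixr "\<oplus>" 65) where
  "u \<oplus> v = Node (children u @ children v)"

fun edges :: "plane_tree \<Rightarrow> nat" where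
  "edges (Node ts) = (\<Sum>T\<leftarrow>ts. edges T + 1)"

fun leaves :: "plane_tree \<Rightarrow> nat" where
  "leaves (Node ts) = (if ts = [] then 1 else (\<Sum>T\<leftarrow>ts. leaves T))"

fun sub :: "plane_tree \<Rightarrow> nat" where
  "sub (Node ts) = length ts"

lemma size_last_less [termination_simp]:
  "ts \<noteq> [] \<Longrightarrow> size (last ts) < Suc (size_list size ts)"
  using size_list_estimation'[OF last_in_set order.refl] by (simp add: less_Suc_eq_le)

fun rpath :: "plane_tree \<Rightarrow> nat" where
  "rpath (Node ts) = (if ts = [] then 0 else 1 + rpath (last ts))"

text \<open>Plane trees with these operations form the free Catalan structure: every element other
  than \<open>cat_e\<close> is \<open>cat_lam u \<oplus> v\<close> for exactly one pair \<open>(u, v)\<close>, where \<open>cat_lam u \<oplus> v\<close> is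
  \<open>cat_lam u\<close> if \<open>v\<close> is \<open>cat_e\<close>.\<close>

lemma cat_plus_monoid:
  "cat_e \<oplus> v = v" "v \<oplus> cat_e = v" "(u \<oplus> v) \<oplus> w = u \<oplus> (v \<oplus> w)"
  by (simp_all add: cat_e_def cat_plus_def)

lemma cat_lam_plus_neq_e: "cat_lam u \<oplus> v \<noteq> cat_e"
  by (simp add: cat_e_def cat_lam_def cat_plus_def)

lemma cat_unique_decomp:
  assumes "T \<noteq> cat_e"
  shows "\<exists>!(u, v). T = cat_lam u \<oplus> v"
proof -
  from assms obtain a as where T: "T = Node (a # as)"
    by (cases T) (auto simp: cat_e_def neq_Nil_conv)
  have "T = cat_lam u \<oplus> v \<longleftrightarrow> u = a \<and> v = Node as" for u v
    by (cases v) (auto simp: T cat_lam_def cat_plus_def)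
  then show ?thesis
    by (intro ex1I[of _ "(a, Node as)"]) (auto split: prod.splits)
qed

text \<open>The recursive clauses for the statistics on the free Catalan structure.\<close>

lemma edges_clauses:
  "edges cat_e = 0" "edges (cat_lam v) = edges v + 1" "edges (u \<oplus> v) = edges u + edges v"
  by (cases u; cases v; simp add: cat_e_def cat_lam_def cat_plus_def)+

lemma leaves_clauses:
  "leaves cat_e = 1" "leaves (cat_lam v) = leaves v"
  "u \<noteq> cat_e \<Longrightarrow> v \<noteq> cat_e \<Longrightarrow> leaves (u \<oplus> v) = leaves u + leaves v"
  by (cases u; cases v; simp add: cat_e_def cat_lam_def cat_plus_def)+

lemma sub_clauses:
  "sub cat_e = 0" "sub (cat_lam v) = 1"
  "u \<noteq> cat_e \<Longrightarrow> v \<noteq> cat_e \<Longrightarrow> sub (u \<oplus> v) = sub u + sub v"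
  by (cases u; cases v; simp add: cat_e_def cat_lam_def cat_plus_def)+

lemma rpath_clauses:
  "rpath cat_e = 0" "rpath (cat_lam v) = 1 + rpath v"
  "u \<noteq> cat_e \<Longrightarrow> v \<noteq> cat_e \<Longrightarrow> rpath (u \<oplus> v) = rpath v"
  by (cases u; cases v; simp add: cat_e_def cat_lam_def cat_plus_def)+

lemma finite_edges_le: "finite {T. edges T \<le> n}"
proof (induction n)
  case 0
  have "{T. edges T \<le> 0} \<subseteq> {Node []}"
  proof
    fix T assume "T \<in> {T. edges T \<le> 0}"
    then show "T \<in> {Node []}"
      by (cases T; cases "children T") auto
  qed
  then show ?case
    using finite_subset by blast
next
  case (Suc n)
  let ?S = "{T. edges T \<le> n}"
  have "{T. edges T \<le> Suc n} \<subseteq> insert cat_e ((\<lambda>(u, v). cat_lam u \<oplus> v) ` (?S \<times> ?S))"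
  proof
    fix T assume T: "T \<in> {T. edges T \<le> Suc n}"
    show "T \<in> insert cat_e ((\<lambda>(u, v). cat_lam u \<oplus> v) ` (?S \<times> ?S))"
    proof (cases "T = cat_e")
      case False
      then obtain u v where uv: "T = cat_lam u \<oplus> v"
        using cat_unique_decomp by blast
      then have "u \<in> ?S" "v \<in> ?S"
        using T by (auto simp: edges_clauses)
      then show ?thesis
        using uv by auto
    qed simp
  qed
  then show ?case
    using Suc finite_subset by blast
qed

lemma finite_edges_eq: "finite {T. edges T = n}"
  by (rule finite_subset[OF _ finite_edges_le[of n]]) auto


section \<open>Formal power series in four variables\<close>

text \<open>\<open>\<rat>[[u]][[q]][[p]][[t]]\<close>: the coefficient of \<open>t\<^sup>n p\<^sup>i q\<^sup>j u\<^sup>k\<close> is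
  \<open>fps_nth (fps_nth (fps_nth (fps_nth f n) i) j) k\<close>.\<close>

type_synonym series_pqu = "rat fps fps fps"
type_synonym series = "series_pqu fps"

definition p0 :: series_pqu where "p0 = fps_X"
definition q0 :: series_pqu where "q0 = fps_const fps_X"
definition u0 :: series_pqu where "u0 = fps_const (fps_const fps_X)"

definition t :: series where "t = fps_X"
definition p :: series where "p = fps_const p0"
definition q :: series where "q = fps_const q0"
definition u :: series where "u = fps_const u0"

text \<open>There are only finitely many trees of each size (\<open>finite_edges_eq\<close>), so that the sum over
  all trees of \<open>t\<^sup>|\<^sup>T\<^sup>| w(T)\<close> is the series in \<open>t\<close> with the following coefficients.\<close>

definition tree_series :: "(plane_tree \<Rightarrow> series_pqu) \<Rightarrow> series" where
  "tree_series w = Abs_fps (\<lambda>n. \<Sum>T | edges T = n. w T)"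

definition F :: series where
  "F = tree_series (\<lambda>T. u0 ^ leaves T)"

definition G :: series where
  "G = tree_series (\<lambda>T. p0 ^ sub T * q0 ^ rpath T * u0 ^ leaves T)"

lemma fps_nth_sum4:
  "fps_nth (fps_nth (fps_nth (sum f A) i) j) k
    = (\<Sum>x\<in>A. fps_nth (fps_nth (fps_nth (f x) i) j) k)"
  by (simp add: fps_sum_nth)

lemma monomial_nth:
  "fps_nth (fps_nth (fps_nth (p0 ^ a * q0 ^ b * u0 ^ c) i) j) k
    = (if a = i \<and> b = j \<and> c = k then 1 else 0)"
  by (simp add: p0_def q0_def u0_def fps_const_power fps_X_power_mult_nth fps_X_power_iff
      flip: mult.assoc)

lemma G_nth:
  "fps_nth (fps_nth (fps_nth (fps_nth G n) i) j) k
    = of_nat (card {T. edges T = n \<and> sub T = i \<and> rpath T = j \<and> leaves T = k})"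
proof -
  have "fps_nth (fps_nth (fps_nth (fps_nth G n) i) j) k
    = (\<Sum>T | edges T = n. if sub T = i \<and> rpath T = j \<and> leaves T = k then 1 else 0)"
    by (simp add: G_def tree_series_def fps_nth_sum4 monomial_nth)
  also have "\<dots> = of_nat (card ({T. edges T = n} \<inter> {T. sub T = i \<and> rpath T = j \<and> leaves T = k}))"
    by (simp add: sum.If_cases finite_edges_eq)
  also have "{T. edges T = n} \<inter> {T. sub T = i \<and> rpath T = j \<and> leaves T = k}
    = {T. edges T = n \<and> sub T = i \<and> rpath T = j \<and> leaves T = k}"
    by auto
  finally show ?thesis .
qed

definition Delta :: series where
  "Delta = (1 - t + t * u) ^ 2 - 4 * t * u"

definition sqrt_Delta :: series where
  "sqrt_Delta = (THE s. s ^ 2 = Delta \<and> fps_nth s 0 = 1)"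

text \<open>Existence and uniqueness of the square root.\<close>

fun fps_sqrt_coeff :: "'a \<Rightarrow> 'a :: idom fps \<Rightarrow> nat \<Rightarrow> 'a" where
  "fps_sqrt_coeff h f 0 = 1"
| "fps_sqrt_coeff h f (Suc n) =
    h * (fps_nth f (Suc n) - (\<Sum>k<n. fps_sqrt_coeff h f (Suc k) * fps_sqrt_coeff h f (n - k)))"

declare fps_sqrt_coeff.simps [simp del]

lemma fps_sqrt_ex1:
  fixes f :: "'a :: idom fps" and h :: 'a
  assumes h: "2 * h = 1" and f0: "fps_nth f 0 = 1"
  shows "\<exists>!s. s ^ 2 = f \<and> fps_nth s 0 = 1"
proof (rule ex_ex1I)
  let ?c = "fps_sqrt_coeff h f"
  let ?s = "Abs_fps ?c"
  have "fps_nth (?s ^ 2) n = fps_nth f n" for n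
  proof (cases n)
    case (Suc m)
    have "fps_nth (?s ^ 2) n = (\<Sum>k\<le>Suc m. ?c k * ?c (Suc m - k))"
      by (simp only: Suc power2_eq_square fps_mult_nth atLeast0AtMost fps_nth_Abs_fps)
    also have "\<dots> = ?c (Suc m) + (\<Sum>k\<le>m. ?c (Suc k) * ?c (m - k))"
      by (subst sum.atMost_Suc_shift) (simp add: fps_sqrt_coeff.simps(1))
    also have "(\<Sum>k\<le>m. ?c (Suc k) * ?c (m - k))
        = (\<Sum>k<m. ?c (Suc k) * ?c (m - k)) + ?c (Suc m)"
      by (simp add: fps_sqrt_coeff.simps(1) lessThan_Suc_atMost[symmetric])
    also have "?c (Suc m) + ((\<Sum>k<m. ?c (Suc k) * ?c (m - k)) + ?c (Suc m))
        = 2 * ?c (Suc m) + (\<Sum>k<m. ?c (Suc k) * ?c (m - k))"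
      by simp
    also have "2 * ?c (Suc m) = fps_nth f (Suc m) - (\<Sum>k<m. ?c (Suc k) * ?c (m - k))"
      by (subst fps_sqrt_coeff.simps(2)) (simp only: mult.assoc[symmetric] h mult_1_left)
    finally show ?thesis
      by (simp add: Suc)
  qed (simp add: power2_eq_square f0 fps_sqrt_coeff.simps(1))
  then show "\<exists>s. s ^ 2 = f \<and> fps_nth s 0 = 1"
    by (intro exI[of _ ?s]) (simp add: fps_eq_iff fps_sqrt_coeff.simps(1))
next
  fix s s' :: "'a fps"
  assume s: "s ^ 2 = f \<and> fps_nth s 0 = 1" and s': "s' ^ 2 = f \<and> fps_nth s' 0 = 1"
  have "(1 :: 'a) + 1 \<noteq> 0"
    using h by (metis mult_zero_left one_add_one zero_neq_one)
  then have "s \<noteq> - s'"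
    using s s' by (metis add.right_inverse add_eq_0_iff fps_neg_nth)
  then show "s = s'"
    using s s' by (metis power2_eq_iff)
qed

lemma sqrt_Delta: "sqrt_Delta ^ 2 = Delta" "fps_nth sqrt_Delta 0 = 1"
proof -
  have "2 * fps_const (fps_const (fps_const (1 / 2))) = (1 :: series_pqu)"
    by (simp add: numeral_fps_const)
  moreover have "fps_nth Delta 0 = 1"
    by (simp add: Delta_def t_def power2_eq_square)
  ultimately have "\<exists>!s. s ^ 2 = Delta \<and> fps_nth s 0 = 1"
    by (rule fps_sqrt_ex1)
  from theI'[OF this] show "sqrt_Delta ^ 2 = Delta" "fps_nth sqrt_Delta 0 = 1"
    by (simp_all add: sqrt_Delta_def)
qed

text \<open>The coefficient ring is not a field, but division by a series whose constant coefficient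
  (with respect to \<open>t\<close>) is a nonzero rational number is division in the ring of series.\<close>

lemma series_divide:
  fixes f g :: series
  assumes "fps_nth g 0 = fps_const (fps_const (fps_const c))" "c \<noteq> 0"
  shows "f / g * g = f"
proof -
  have inv: "inverse (fps_nth g 0) * fps_nth g 0 = 1"
    using assms by (simp add: fps_const_inverse)
  have "fps_nth g 0 \<noteq> 0"
    using assms by simp
  then have "f / g * g = f * (inverse g * g)"
    by (simp add: fps_divide_unit mult.assoc)
  also have "inverse g = fps_right_inverse g (inverse (fps_nth g 0))"
    by (rule fps_inverse_def)
  also have "\<dots> * g = 1"
    by (rule fps_left_inverse'[OF inv]) (subst mult.commute, rule inv)
  finally show ?thesis by simp
qed

end

theory Submission
  imports Defs
begin

text \<open>Splitting off the first child of the root, \<open>T = cat_lam a \<oplus> v\<close>, turns the recursive clauses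
  of the statistics into linear equations. With \<open>H\<close> the series \<open>G\<close> at \<open>p = 1\<close>, they are
  \<open>F - u = t F + t F (F - u)\<close>, \<open>H - u = t q H + t F (H - u)\<close> and
  \<open>G - u = t p q H + t p F (G - u)\<close>: in each, the first summand collects the trees with \<open>v = cat_e\<close>.
  Eliminating \<open>H\<close> gives the first formula, and the quadratic equation for \<open>F\<close> gives
  \<open>2 t F = 1 - t + t u - sqrt_Delta\<close> and hence the second one.\<close>

lemma tree_series_nth: "fps_nth (tree_series w) n = (\<Sum>T | edges T = n. w T)"
  by (simp add: tree_series_def)

lemma edges_eq_0_iff: "edges T = 0 \<longleftrightarrow> T = cat_e"
  by (cases T; cases "children T") (auto simp: cat_e_def)

lemma tree_series_nth_0: "fps_nth (tree_series w) 0 = w cat_e"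
  by (simp add: tree_series_nth edges_eq_0_iff)

lemma tree_series_diff: "tree_series (\<lambda>T. w T - w' T) = tree_series w - tree_series w'"
  by (rule fps_ext) (simp add: tree_series_nth sum_subtractf)

lemma tree_series_scale: "tree_series (\<lambda>T. c * w T) = fps_const c * tree_series w"
  by (rule fps_ext) (simp add: tree_series_nth sum_distrib_left)

lemma tree_series_single: "tree_series (\<lambda>T. if T = cat_e then c else 0) = fps_const c"
proof (rule fps_ext)
  fix n
  show "fps_nth (tree_series (\<lambda>T. if T = cat_e then c else 0)) n = fps_nth (fps_const c) n"
    by (cases n) (auto simp: tree_series_nth edges_eq_0_iff edges_clauses intro!: sum.neutral)
qed

text \<open>The Cauchy product groups the pairs by the size of their first entry; these groups are
  finite and disjoint.\<close>

lemma tree_series_mult_nth: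
  "fps_nth (tree_series f * tree_series g) n = (\<Sum>(a, v) | edges a + edges v = n. f a * g v)"
proof -
  have "fps_nth (tree_series f * tree_series g) n
    = (\<Sum>i\<le>n. \<Sum>(a, v) \<in> {a. edges a = i} \<times> {v. edges v = n - i}. f a * g v)"
    by (simp add: fps_mult_nth tree_series_nth sum_product sum.cartesian_product atLeast0AtMost)
  also have "\<dots> = (\<Sum>(a, v) \<in> (\<Union>i\<le>n. {a. edges a = i} \<times> {v. edges v = n - i}). f a * g v)"
    by (rule sum.UNION_disjoint[symmetric]) (auto intro: finite_edges_eq)
  also have "(\<Union>i\<le>n. {a. edges a = i} \<times> {v. edges v = n - i}) = {(a, v). edges a + edges v = n}"
    by auto
  finally show ?thesis .
qed

text \<open>Grafting is a bijection from pairs of trees onto trees other than \<open>cat_e\<close>,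
  and the edge from the root to \<open>a\<close> accounts for the successor.\<close>

lemma sum_edges_Suc:
  "(\<Sum>T | edges T = Suc n. w T) = (\<Sum>(a, v) | edges a + edges v = n. w (cat_lam a \<oplus> v))"
proof -
  have "bij_betw (\<lambda>(a, v). cat_lam a \<oplus> v) {(a, v). edges a + edges v = n} {T. edges T = Suc n}"
  proof (rule bij_betw_imageI)
    show "inj_on (\<lambda>(a, v). cat_lam a \<oplus> v) {(a, v). edges a + edges v = n}"
      by (auto simp: inj_on_def cat_lam_def cat_plus_def plane_tree.expand)
    have "T \<in> (\<lambda>(a, v). cat_lam a \<oplus> v) ` {(a, v). edges a + edges v = n}"
      if "edges T = Suc n" for T
    proof -
      from that have "T \<noteq> cat_e"
        by (auto simp: edges_clauses)
      then obtain a v where "T = cat_lam a \<oplus> v"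
        using cat_unique_decomp by blast
      with that show ?thesis
        by (force simp: edges_clauses)
    qed
    then show "(\<lambda>(a, v). cat_lam a \<oplus> v) ` {(a, v). edges a + edges v = n} = {T. edges T = Suc n}"
      by (auto simp: edges_clauses)
  qed
  from sum.reindex_bij_betw[OF this, of w] show ?thesis
    by (simp add: case_prod_unfold)
qed

lemma tree_series_first_child:
  assumes "\<And>a v. w (cat_lam a \<oplus> v) = (if v = cat_e then z a else x a * y v)"
  shows "tree_series w = fps_const (w cat_e)
    + t * (tree_series z + tree_series x * (tree_series y - fps_const (y cat_e)))"
proof -
  \<comment> \<open>\<open>?d\<close> has series 1 and \<open>?y\<close> vanishes at
    \<open>cat_e\<close>, so both cases of the assumption merge into one sum over pairs, which is a
    coefficient of products.\<close>
  let ?d = "\<lambda>v. if v = cat_e then 1 else 0"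
  let ?y = "\<lambda>v. y v - (if v = cat_e then y cat_e else 0)"
  have "fps_nth (tree_series w) (Suc n)
    = fps_nth (tree_series z * tree_series ?d + tree_series x * tree_series ?y) n" for n
    by (simp add: tree_series_nth sum_edges_Suc assms tree_series_mult_nth
        flip: sum.distrib) (intro sum.cong, auto)
  then have "tree_series w = fps_const (w cat_e)
    + t * (tree_series z * tree_series ?d + tree_series x * tree_series ?y)"
    by (intro fps_ext) (case_tac n; simp add: t_def tree_series_nth_0)
  then show ?thesis
    by (simp add: tree_series_diff tree_series_single)
qed

lemma first_child_clauses:
  "leaves (cat_lam a \<oplus> v) = (if v = cat_e then leaves a else leaves a + leaves v)"
  "sub (cat_lam a \<oplus> v) = Suc (sub v)"
  "rpath (cat_lam a \<oplus> v) = (if v = cat_e then Suc (rpath a) else rpath v)"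
  by (cases v; auto simp: cat_e_def cat_lam_def cat_plus_def)+

text \<open>If the root has a single child, the rightmost path continues inside that child, but the
  number of children there no longer counts. This calls for a series that keeps \<open>q\<close> and
  drops \<open>p\<close>.\<close>

definition H :: series where
  "H = tree_series (\<lambda>T. q0 ^ rpath T * u0 ^ leaves T)"

lemma F_eq: "F = u + t * (F + F * (F - u))"
  unfolding F_def u_def
  by (subst tree_series_first_child[where x = "\<lambda>T. u0 ^ leaves T" and y = "\<lambda>T. u0 ^ leaves T"
        and z = "\<lambda>T. u0 ^ leaves T"])
    (simp_all add: first_child_clauses leaves_clauses power_add)

lemma H_eq: "H = u + t * (q * H + F * (H - u))"
  unfolding F_def H_def u_def q_def
  by (subst tree_series_first_child[where x = "\<lambda>T. u0 ^ leaves T"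
        and y = "\<lambda>T. q0 ^ rpath T * u0 ^ leaves T"
        and z = "\<lambda>T. q0 * (q0 ^ rpath T * u0 ^ leaves T)"])
    (simp_all add: first_child_clauses leaves_clauses rpath_clauses power_add tree_series_scale
      algebra_simps)

lemma G_eq: "G = u + t * (p * q * H + p * F * (G - u))"
  unfolding F_def H_def G_def u_def q_def p_def
  by (subst tree_series_first_child[where x = "\<lambda>T. p0 * u0 ^ leaves T"
        and y = "\<lambda>T. p0 ^ sub T * q0 ^ rpath T * u0 ^ leaves T"
        and z = "\<lambda>T. (p0 * q0) * (q0 ^ rpath T * u0 ^ leaves T)"])
    (simp_all add: first_child_clauses leaves_clauses rpath_clauses sub_clauses power_add
      tree_series_scale algebra_simps flip: fps_const_mult)

text \<open>Both sides have square \<open>Delta\<close>; the constant coefficient 1 in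
  \<open>t\<close> rules out the opposite sign.\<close>

lemma sqrt_Delta_eq: "sqrt_Delta = 1 - t + t * u - 2 * t * F"
proof -
  let ?s = "1 - t + t * u - 2 * t * F"
  \<comment> \<open>The term added to \<open>Delta\<close> is a multiple of the defect in
    \<open>F_eq\<close>, hence zero.\<close>
  have "?s ^ 2 = Delta + 4 * t * (u + t * (F + F * (F - u)) - F)"
    unfolding Delta_def by algebra
  then have "?s ^ 2 = sqrt_Delta ^ 2"
    by (simp add: sqrt_Delta flip: F_eq)
  moreover have "fps_nth ?s 0 \<noteq> fps_nth (- sqrt_Delta) 0"
    by (simp add: t_def sqrt_Delta(2))
  then have "?s \<noteq> - sqrt_Delta"
    by metis
  ultimately show ?thesis
    by (auto simp: power2_eq_iff)
qed

text \<open>The series form an integral domain, so the nonzero factor \<open>g\<close> cancels from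
  \<open>h * g = f / g * g\<close>.\<close>

lemma series_eq_divideI:
  fixes f g h :: series
  assumes "h * g = f" "fps_nth g 0 = fps_const (fps_const (fps_const c))" "c \<noteq> 0"
  shows "h = f / g"
proof -
  have "g \<noteq> 0"
    using assms(2,3) by auto
  then show ?thesis
    using series_divide[OF assms(2,3), of f] assms(1) by (metis mult_right_cancel)
qed

theorem theorem4p3:
  shows "G = u + (t * p * q * u * (1 - t * F)) / ((1 - t * p * F) * (1 - t * F - t * q))
    \<and> G = u + (t * p * q * u * (1 + t - t * u + sqrt_Delta))
            / (2 * (1 - t * q - t * p * u)
                + (1 - t + t * u - sqrt_Delta) * (t * p * (u + q - 1) - 1))"
proof
  let ?N = "t * p * q * u * (1 - t * F)" and ?D = "(1 - t * p * F) * (1 - t * F - t * q)"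
  have "H * (1 - t * F - t * q) = u * (1 - t * F)"
    using H_eq by algebra
  moreover have "(G - u) * (1 - t * p * F) = t * p * q * H"
    using G_eq by algebra
  ultimately have GD: "(G - u) * ?D = ?N"
    by algebra
  then have "G - u = ?N / ?D"
    by (rule series_eq_divideI[where c = 1]) (simp_all add: t_def)
  then show "G = u + ?N / ?D"
    by (simp add: algebra_simps)

  let ?N' = "t * p * q * u * (1 + t - t * u + sqrt_Delta)"
  let ?D' = "2 * (1 - t * q - t * p * u)
    + (1 - t + t * u - sqrt_Delta) * (t * p * (u + q - 1) - 1)"
  have "?N' = 2 * ?N"
    unfolding sqrt_Delta_eq by algebra
  \<comment> \<open>After substituting for \<open>sqrt_Delta\<close>, \<open>?D'\<close> is linear
    in \<open>F\<close> while \<open>2 * ?D\<close> is quadratic; \<open>F_eq\<close> reconciles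
    them.\<close>
  moreover have "?D' = 2 * ?D"
    unfolding sqrt_Delta_eq using F_eq by algebra
  ultimately have "(G - u) * ?D' = ?N'"
    by (simp only: mult.left_commute[of "G - u" 2] GD)
  then have "G - u = ?N' / ?D'"
    by (rule series_eq_divideI[where c = 2])
      (simp_all add: t_def sqrt_Delta(2) numeral_fps_const)
  then show "G = u + ?N' / ?D'"
    by (simp add: algebra_simps)
qed

end
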